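(* Let $k\geq 1$ be fixed and $p\neq 0$ real. The inequality $$\frac{2}{k+2}\left( \frac{\sin x}{x}\right) ^{kp}+\frac{k}{k+2}\left( \frac{\tan x}{x}\right) ^{p}>1$$ holds for all $x\in (0,\pi/2)$ if and only if $p>0$ or $p\leq -\dfrac{\ln (k+2)-\ln 2}{k(\ln \pi -\ln 2)}$. *)

theory Defs
  imports Complex_Main
begin

end

theory Submission
  imports Defs "HOL-Analysis.Analysis"
begin

text \<open>
  For \<open>p > 0\<close> the estimate \<open>exp z \<ge> 1 + z\<close> reduces the claim to \<open>(sin x)\<^sup>3 > x\<^sup>3 cos x\<close>.
  For \<open>p = - q < 0\<close>, letting \<open>x\<close> tend to \<open>pi/2\<close> shows that \<open>q\<close> is at least the critical
  exponent \<open>ln ((k + 2) / 2) / (k * ln (pi / 2))\<close>, and convexity in \<open>q\<close> (with equality at \<open>q = 0\<close>)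
  reduces sufficiency to the critical exponent itself.

  There, put \<open>t = ln ((k + 2) / 2)\<close>, \<open>P = ln (pi / 2)\<close>, \<open>\<delta> = 1 - ln (x / sin x) / P\<close> and
  \<open>\<gamma> = - ln (x / tan x) / P\<close>. The inequality then bounds \<open>\<gamma> / 2\<close> by a quantity depending only on
  \<open>\<delta>\<close> and \<open>t\<close> that is nondecreasing in \<open>t\<close>, so that the case \<open>k = 1\<close> suffices. For \<open>k = 1\<close> the claim is
  \<open>q ln (x / sin x) + ln (2 + (cos x)\<^sup>q) > ln 3\<close>, with equality in the limit at both ends of
  \<open>(0, pi/2)\<close>. It follows by differentiating three times, each time up to a positive factor: the
  property of changing sign at most once, from plus to minus, passes to any antiderivative that
  vanishes at \<open>0\<close>.
\<close>

section \<open>Sign changes from plus to minus, and antiderivatives\<close>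

text \<open>No crossing point is named, so functions of constant sign are covered too. Passing from
  \<open>\<le>\<close> to \<open><\<close> allows at most one zero and makes an antiderivative
  strictly decreasing once its derivative has stopped being positive.\<close>

definition crosses_down :: "real \<Rightarrow> real \<Rightarrow> (real \<Rightarrow> real) \<Rightarrow> bool" where
  "crosses_down a b f \<longleftrightarrow> (\<forall>x y. a < x \<longrightarrow> x < y \<longrightarrow> y < b \<longrightarrow> f x \<le> 0 \<longrightarrow> f y < 0)"

lemma crosses_downD: "crosses_down a b f \<Longrightarrow> a < x \<Longrightarrow> x < y \<Longrightarrow> y < b \<Longrightarrow> f x \<le> 0 \<Longrightarrow> f y < 0"
  unfolding crosses_down_def by blast

lemma crosses_down_mult_pos:
  assumes "crosses_down a b f" "\<And>x. a < x \<Longrightarrow> x < b \<Longrightarrow> 0 < h x"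
    and "\<And>x. a < x \<Longrightarrow> x < b \<Longrightarrow> g x = h x * f x"
  shows "crosses_down a b g"
  unfolding crosses_down_def
proof (intro allI impI)
  fix x y assume xy: "a < x" "x < y" "y < b" "g x \<le> 0"
  then have "h x * f x \<le> 0" using assms(3)[of x] by auto
  then have "f x \<le> 0" using assms(2)[of x] xy by (simp add: mult_le_0_iff)
  then have "f y < 0" using crosses_downD[OF assms(1)] xy by blast
  then show "g y < 0" using assms(2,3)[of y] xy by (simp add: mult_less_0_iff)
qed

text \<open>The function increases strictly on the interval, so its values stay above the limit 0 at
  \<open>a\<close>. A limit replaces the value at \<open>a\<close>, where the functions of interest
  may be singular.\<close>

lemma pos_if_deriv_pos_at_right:
  fixes f f' :: "real \<Rightarrow> real"
  assumes "a < x" and lim: "(f \<longlongrightarrow> 0) (at_right a)"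
    and der: "\<And>z. a < z \<Longrightarrow> z \<le> x \<Longrightarrow> (f has_real_derivative f' z) (at z)"
    and pos: "\<And>z. a < z \<Longrightarrow> z < x \<Longrightarrow> 0 < f' z"
  shows "0 < f x"
proof -
  have mono: "f u < f v" if "a < u" "u < v" "v \<le> x" for u v
  proof (rule DERIV_pos_imp_increasing_open[OF that(2)])
    show "\<exists>y. DERIV f z :> y \<and> y > 0" if "u < z" "z < v" for z
      using der[of z] pos[of z] that \<open>a < u\<close> \<open>v \<le> x\<close> by (intro exI[of _ "f' z"]) auto
    show "continuous_on {u..v} f"
    proof (intro continuous_at_imp_continuous_on ballI)
      show "isCont f z" if "z \<in> {u..v}" for z
        using that \<open>a < u\<close> \<open>v \<le> x\<close> by (intro DERIV_isCont[OF der]) auto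
    qed
  qed
  \<comment> \<open>Comparison with the limit gives only \<open>0 \<le> f w\<close>; the further
    strict increase from \<open>w\<close> to \<open>x\<close> restores strictness.\<close>
  define w where "w = (a + x) / 2"
  have w: "a < w" "w < x" using \<open>a < x\<close> by (auto simp: w_def)
  have "eventually (\<lambda>z. f z \<le> f w) (at_right a)"
    using eventually_at_right_real[OF w(1)]
  proof eventually_elim
    case (elim z)
    then show ?case using mono[of z w] w by auto
  qed
  then have "0 \<le> f w"
    using tendsto_upperbound[OF lim] by simp
  then show ?thesis using mono[of w x] w by auto
qed

text \<open>If \<open>f'\<close> were positive on all of \<open>(a, x)\<close>, then
  \<open>f x\<close> would be positive. Hence \<open>f'\<close> is nonpositive somewhere before
  \<open>x\<close>, and so negative from \<open>x\<close> on.\<close>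

lemma crosses_down_deriv_imp_decreasing:
  fixes f f' :: "real \<Rightarrow> real"
  assumes lim: "(f \<longlongrightarrow> 0) (at_right a)"
    and der: "\<And>z. a < z \<Longrightarrow> z < b \<Longrightarrow> (f has_real_derivative f' z) (at z)"
    and cross: "crosses_down a b f'"
    and xy: "a < x" "f x \<le> 0" "x \<le> u" "u < v" "v < b"
  shows "f v < f u"
proof -
  obtain z where z: "a < z" "z < x" "f' z \<le> 0"
    using pos_if_deriv_pos_at_right[OF xy(1) lim, of f'] der xy by fastforce
  have neg: "f' w < 0" if "z < w" "w < b" for w
    using crosses_downD[OF cross z(1) that z(3)] .
  show ?thesis
  proof (rule DERIV_neg_imp_decreasing[OF \<open>u < v\<close>])
    show "\<exists>y. DERIV f w :> y \<and> y < 0" if "u \<le> w" "w \<le> v" for w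
      using der[of w] neg[of w] that xy z by (intro exI[of _ "f' w"]) auto
  qed
qed

lemma crosses_down_antideriv:
  fixes f f' :: "real \<Rightarrow> real"
  assumes "(f \<longlongrightarrow> 0) (at_right a)"
    and "\<And>z. a < z \<Longrightarrow> z < b \<Longrightarrow> (f has_real_derivative f' z) (at z)"
    and "crosses_down a b f'"
  shows "crosses_down a b f"
  unfolding crosses_down_def
  using crosses_down_deriv_imp_decreasing[OF assms] by fastforce

text \<open>After a point with \<open>f x \<le> 0\<close> the function would decrease strictly,
  which contradicts its return to 0 at \<open>b\<close>.\<close>

lemma pos_if_deriv_crosses_down:
  fixes f f' :: "real \<Rightarrow> real"
  assumes "(f \<longlongrightarrow> 0) (at_right a)" and lim: "(f \<longlongrightarrow> 0) (at_left b)"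
    and "\<And>z. a < z \<Longrightarrow> z < b \<Longrightarrow> (f has_real_derivative f' z) (at z)"
    and "crosses_down a b f'" and x: "a < x" "x < b"
  shows "0 < f x"
proof (rule ccontr)
  assume "\<not> 0 < f x"
  then have fx: "f x \<le> 0" by simp
  note decr = crosses_down_deriv_imp_decreasing[OF assms(1,3,4) x(1) fx]
  define w where "w = (x + b) / 2"
  have w: "x < w" "w < b" using x by (auto simp: w_def)
  have "eventually (\<lambda>z. f z \<le> f w) (at_left b)"
    using eventually_at_left_real[OF w(2)]
  proof eventually_elim
    case (elim z)
    then show ?case using decr[of w z] w by auto
  qed
  then have "0 \<le> f w"
    using tendsto_upperbound[OF lim] by simp
  then show False using decr[of x w] fx w by auto
qed

section \<open>The case \<open>k = 1\<close> at the critical exponent\<close>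

lemma sin_cos_pos:
  assumes "0 < x" "x < pi / 2"
  shows "0 < sin x" "0 < cos x" "cos x < 1"
  using assms sin_gt_zero[of x] cos_gt_zero[of x] cos_monotone_0_pi[of 0 x] by auto

lemma cos_powr_antimono:
  assumes "0 < x" "x < y" "y < pi / 2" "a < 0"
  shows "cos x powr a < cos y powr a"
  using assms cos_monotone_0_pi[of x y] cos_gt_zero[of y] by (intro powr_less_mono2_neg) auto

text \<open>
  With \<open>r = 1 - q\<close>, the function of \<open>crosses_down_gap\<close> is the derivative of
  \<open>q ln (x / sin x) + ln (2 + (cos x)\<^sup>q)\<close> up to a positive factor, and each of the two functions
  before it is, again up to a positive factor, the derivative of the next.
\<close>

lemma crosses_down_gap_deriv2:
  assumes r: "0 \<le> r" "r < (1::real)"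
  shows "crosses_down 0 (pi/2)
    (\<lambda>x. (1 - r)\<^sup>2 - 2 * r * cos x powr (- r - 1) - r * (r + 1) * cos x powr (-2))"
  unfolding crosses_down_def
proof (intro allI impI)
  fix x y :: real
  assume xy: "0 < x" "x < y" "y < pi / 2"
    and *: "(1 - r)\<^sup>2 - 2 * r * cos x powr (- r - 1) - r * (r + 1) * cos x powr (-2) \<le> 0"
  \<comment> \<open>For \<open>r = 0\<close> the expression is constantly 1. For
    \<open>r > 0\<close> it is strictly decreasing, since the subtracted powers of the cosine have
    negative exponents.\<close>
  have "r \<noteq> 0" using * by auto
  then have "0 < r" using r by simp
  have "2 * r * cos x powr (- r - 1) < 2 * r * cos y powr (- r - 1)"
    using cos_powr_antimono[OF xy, of "- r - 1"] \<open>0 < r\<close> by simp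
  moreover have "r * (r + 1) * cos x powr (-2) < r * (r + 1) * cos y powr (-2)"
    using cos_powr_antimono[OF xy, of "- 2"] \<open>0 < r\<close> by simp
  ultimately show "(1 - r)\<^sup>2 - 2 * r * cos y powr (- r - 1) - r * (r + 1) * cos y powr (-2) < 0"
    using * by simp
qed

lemma crosses_down_gap_deriv:
  assumes r: "0 \<le> r" "r < (1::real)"
  shows "crosses_down 0 (pi/2)
    (\<lambda>x. 2 - cos x powr (- 2 * r) - r * cos x powr (- r - 1) - (1 - r) * cos x powr (1 - r))"
    (is "crosses_down _ _ ?f")
proof (rule crosses_down_antideriv)
  let ?f' = "\<lambda>x. sin x * cos x powr (-r) *
    ((1 - r)\<^sup>2 - 2 * r * cos x powr (- r - 1) - r * (r + 1) * cos x powr (-2))"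
  \<comment> \<open>The value at 0 is 2 - 1 - r - (1 - r) = 0.\<close>
  have "isCont ?f 0" by (intro continuous_intros) auto
  then show "(?f \<longlongrightarrow> 0) (at_right 0)"
    by (auto simp: isCont_def intro: filterlim_mono[OF _ order_refl at_le])
  show "crosses_down 0 (pi/2) ?f'"
  proof (rule crosses_down_mult_pos[OF crosses_down_gap_deriv2[OF r] _ refl])
    show "0 < sin x * cos x powr (-r)" if "0 < x" "x < pi/2" for x
      using sin_cos_pos[OF that] by simp
  qed
  fix x :: real assume x: "0 < x" "x < pi/2"
  note sc = sin_cos_pos[OF x]
  define c where "c = cos x"
  have e: "c powr (- 2 * r - 1) = c powr (-r) * c powr (- r - 1)"
       "c powr (- r - 1 - 1) = c powr (-r) * c powr (-2)"
    using sc by (simp_all flip: powr_add add: c_def algebra_simps)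
  have "(?f has_real_derivative
      sin x * (- 2 * r * c powr (- 2 * r - 1) - r * (r + 1) * c powr (- r - 1 - 1)
       + (1 - r) * (1 - r) * c powr (- r))) (at x)"
    using sc by (auto intro!: derivative_eq_intros simp: c_def algebra_simps)
  also have "sin x * (- 2 * r * c powr (- 2 * r - 1) - r * (r + 1) * c powr (- r - 1 - 1)
       + (1 - r) * (1 - r) * c powr (- r)) = ?f' x"
    unfolding e c_def[symmetric] by (simp add: algebra_simps power2_eq_square)
  finally show "(?f has_real_derivative ?f' x) (at x)" .
qed

lemma crosses_down_gap:
  assumes r: "0 \<le> r" "r < (1::real)"
  shows "crosses_down 0 (pi/2)
    (\<lambda>x. sin x * (2 * cos x powr r + cos x) / (2 * cos x powr (1 + r) + 1) - x)"
    (is "crosses_down _ _ ?f")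
proof (rule crosses_down_antideriv)
  let ?g = "\<lambda>x. 2 - cos x powr (- 2 * r) - r * cos x powr (- r - 1) - (1 - r) * cos x powr (1 - r)"
  let ?h = "\<lambda>x. 2 * cos x powr (2 * r) * (sin x)\<^sup>2 / (2 * cos x powr (1 + r) + 1)\<^sup>2"
  have "isCont ?f 0" by (intro continuous_intros) (auto)
  then show "(?f \<longlongrightarrow> 0) (at_right 0)"
    by (auto simp: isCont_def intro: filterlim_mono[OF _ order_refl at_le])
  have den: "2 * c powr (1 + r) + 1 > 0" for c :: real
    using powr_ge_zero[of c "1+r"] by linarith
  show "crosses_down 0 (pi/2) (\<lambda>x. ?h x * ?g x)"
  proof (rule crosses_down_mult_pos[OF crosses_down_gap_deriv[OF r] _ refl])
    show "0 < ?h x" if "0 < x" "x < pi/2" for x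
      using sin_cos_pos[OF that] den[of "cos x"] by simp
  qed
  fix x :: real assume x: "0 < x" "x < pi/2"
  note sc = sin_cos_pos[OF x]
  \<comment> \<open>All powers that occur are products of integer powers of \<open>c\<close> and
    \<open>u\<close>, so the derivative becomes a rational identity modulo
    \<open>s\<^sup>2 = 1 - c\<^sup>2\<close>.\<close>
  define c s u where "c = cos x" and "s = sin x" and "u = c powr r"
  have cs: "c > 0" "s > 0" "u > 0" "s\<^sup>2 = 1 - c\<^sup>2"
    using sc by (auto simp: c_def s_def u_def sin_squared_eq)
  have e: "c powr (1 + r) = c * u" "c powr (r - 1) = u / c" "c powr (2 * r) = u\<^sup>2"
    "c powr (- 2 * r) = 1 / u\<^sup>2" "c powr (- r - 1) = 1 / (u * c)" "c powr (1 - r) = c / u"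
    using cs(1) powr_add[of c r r] powr_minus[of c "2 * r"]
    by (simp_all add: u_def powr_add powr_diff powr_minus power2_eq_square divide_simps)
  have "(?f has_real_derivative
     ((c * (2 * u + c) + s * (- 2 * r * s * (u / c) - s)) * (2 * (c * u) + 1)
      - s * (2 * u + c) * (- 2 * (1 + r) * s * u)) / (2 * (c * u) + 1)\<^sup>2 - 1) (at x)"
    using sc den[of c] unfolding e[symmetric] unfolding u_def s_def c_def
    by (auto intro!: derivative_eq_intros simp: power2_eq_square algebra_simps)
  also have "((c * (2 * u + c) + s * (- 2 * r * s * (u / c) - s)) * (2 * (c * u) + 1)
      - s * (2 * u + c) * (- 2 * (1 + r) * s * u)) / (2 * (c * u) + 1)\<^sup>2 - 1
      = (2 * u\<^sup>2 * s\<^sup>2 / (2 * (c * u) + 1)\<^sup>2) * (2 - 1 / u\<^sup>2 - r * (1 / (u * c)) - (1 - r) * (c / u))"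
    (is "?N / ?d - 1 = _ * ?R")
  proof -
    have "(c * (2 * u + c) + s * (- 2 * r * s * (u / c) - s)) * (2 * (c * u) + 1)
      - s * (2 * u + c) * (- 2 * (1 + r) * s * u) - (2 * (c * u) + 1)\<^sup>2
      = (c * (2 * u + c) - s\<^sup>2 * (2 * r * (u / c) + 1)) * (2 * (c * u) + 1)
      + s\<^sup>2 * (2 * u + c) * (2 * (1 + r) * u) - (2 * (c * u) + 1)\<^sup>2"
      by (simp add: algebra_simps power2_eq_square)
    also have "\<dots> = 2 * u\<^sup>2 * s\<^sup>2 * (2 - 1 / u\<^sup>2 - r * (1 / (u * c)) - (1 - r) * (c / u))"
      unfolding cs(4) using cs(1,3) by (simp add: field_simps) algebra
    finally have eq: "?N - ?d = 2 * u\<^sup>2 * s\<^sup>2 * ?R" .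
    have "0 < 2 * (c * u) + 1" using cs mult_pos_pos[of c u] by linarith
    then have "?d \<noteq> 0" by simp
    then have "?N / ?d - 1 = (?N - ?d) / ?d" by (simp add: diff_divide_distrib)
    then show ?thesis unfolding eq by simp
  qed
  also have "\<dots> = ?h x * ?g x"
    using e by (simp add: c_def s_def)
  finally show "(?f has_real_derivative ?h x * ?g x) (at x)" .
qed

lemma tendsto_arg_over_sin: "((\<lambda>x::real. x / sin x) \<longlongrightarrow> 1) (at 0)"
proof -
  have "((\<lambda>x::real. sin x / x) \<longlongrightarrow> 1) (at 0)"
    using DERIV_sin[of "0::real"] by (simp add: DERIV_def)
  from tendsto_inverse[OF this] show ?thesis by simp
qed

text \<open>From sin (pi / 6) = 1/2. The bound puts the critical exponent for \<open>k = 1\<close>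
  at or below 1, that is, \<open>0 \<le> r\<close>.\<close>

lemma pi_ge_three: "3 \<le> pi"
  using sin_x_le_x[of "pi / 6"] by (simp add: sin_30)

lemma tendsto_cos_powr_at_left_pi_half:
  assumes "0 < q"
  shows "((\<lambda>x. cos x powr q) \<longlongrightarrow> 0) (at_left (pi/2))"
proof -
  have cosl: "(cos \<longlongrightarrow> 0) (at_left (pi/2))"
    using isCont_cos[of "pi/2"] by (auto simp: isCont_def intro: filterlim_mono[OF _ order_refl at_le])
  have "eventually (\<lambda>x. x \<in> {0<..<pi/2}) (at_left (pi/2))"
    by (rule eventually_at_left_real) simp
  then have "eventually (\<lambda>x. 0 \<le> cos x) (at_left (pi/2))"
    by eventually_elim (use sin_cos_pos in \<open>auto intro: less_imp_le\<close>)
  with tendsto_powr'[OF cosl tendsto_const, of q] assms show ?thesis by simp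
qed

text \<open>This is the case \<open>k = 1\<close> multiplied by 3, with x / tan x written as (x /
  sin x) cos x and the common power factored out. The logarithm \<open>?D\<close> of the quotient of
  the two sides vanishes at both ends.\<close>

lemma arg_over_sin_powr_gt:
  fixes q x :: real
  defines "q \<equiv> ln (3/2) / ln (pi/2)"
  assumes x: "0 < x" "x < pi/2"
  shows "3 < (x / sin x) powr q * (2 + cos x powr q)"
proof -
  have q: "0 < q" "q \<le> 1"
    using pi_ge_three by (auto simp: q_def)
  define r where "r = 1 - q"
  have r: "0 \<le> r" "r < 1" using q by (auto simp: r_def)
  let ?E = "\<lambda>x. sin x * (2 * cos x powr r + cos x) / (2 * cos x powr (1 + r) + 1) - x"
  let ?D = "\<lambda>x. q * ln (x / sin x) + ln (2 + cos x powr q) - ln 3"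
  let ?h = "\<lambda>x. q * (2 * cos x powr (1 + r) + 1) / (x * sin x * (2 * cos x powr r + cos x))"
  have pos: "2 + c powr q > 0" "2 * c powr (1 + r) + 1 > 0" for c :: real
    using powr_ge_zero[of c q] powr_ge_zero[of c "1+r"] by linarith+
  have "0 < ?D x"
  proof (rule pos_if_deriv_crosses_down[OF _ _ _ _ x])
    have "((\<lambda>x. x / sin x) \<longlongrightarrow> 1) (at_right (0::real))"
      using tendsto_arg_over_sin by (rule filterlim_mono) (auto intro: at_le)
    moreover have "((\<lambda>x. cos x) \<longlongrightarrow> 1) (at_right (0::real))"
      using isCont_cos[of "0::real"] by (auto simp: isCont_def intro: filterlim_mono[OF _ order_refl at_le])
    ultimately have "(?D \<longlongrightarrow> q * ln 1 + ln (2 + 1 powr q) - ln 3) (at_right 0)"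
      by (intro tendsto_intros) auto
    then show "(?D \<longlongrightarrow> 0) (at_right 0)" by simp
    have "((\<lambda>x. cos x powr q) \<longlongrightarrow> 0) (at_left (pi/2))"
      by (rule tendsto_cos_powr_at_left_pi_half[OF q(1)])
    moreover have "((\<lambda>x. x / sin x) \<longlongrightarrow> (pi/2) / sin (pi/2)) (at_left (pi/2))"
      by (intro tendsto_intros) auto
    ultimately have "(?D \<longlongrightarrow> q * ln ((pi/2) / sin (pi/2)) + ln (2 + 0) - ln 3) (at_left (pi/2))"
      by (intro tendsto_add tendsto_diff tendsto_mult tendsto_ln tendsto_const) auto
    \<comment> \<open>The value of \<open>q\<close> is chosen exactly for this.\<close>
    moreover have "q * ln ((pi/2) / sin (pi/2)) + ln (2 + 0) - ln 3 = 0"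
      using pi_ge_three q(1) by (simp add: q_def ln_div)
    ultimately show "(?D \<longlongrightarrow> 0) (at_left (pi/2))" by simp
    show "crosses_down 0 (pi/2) (\<lambda>x. ?h x * ?E x)"
    proof (rule crosses_down_mult_pos[OF crosses_down_gap[OF r] _ refl])
      show "0 < ?h x" if "0 < x" "x < pi/2" for x
        using sin_cos_pos[OF that] pos(2)[of "cos x"] that q(1)
        by (auto intro!: divide_pos_pos mult_pos_pos add_pos_pos)
    qed
    fix x :: real assume x: "0 < x" "x < pi/2"
    note sc = sin_cos_pos[OF x]
    define c s u where "c = cos x" and "s = sin x" and "u = c powr r"
    have cs: "c > 0" "s > 0" "u > 0" "s * s = 1 - c * c"
      using sc by (auto simp: c_def s_def u_def sin_squared_eq simp flip: power2_eq_square)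
    have e: "c powr q = c / u" "c powr (q - 1) = 1 / u" "c powr (1 + r) = c * u"
      using cs(1) powr_add[of c 1 r] powr_diff[of c 1 r] powr_minus[of c r]
      by (simp_all add: u_def r_def divide_simps)
    have "(?D has_real_derivative
        q * ((s - x * c) / (s * s) / (x / s)) + (- (q * c powr (q - 1) * s)) / (2 + c powr q)) (at x)"
      using sc x pos(1)[of c]
      by (auto intro!: derivative_eq_intros simp: c_def s_def divide_simps)
    also have "q * ((s - x * c) / (s * s) / (x / s)) + (- (q * c powr (q - 1) * s)) / (2 + c powr q)
      = q * (1 / x - c / s - s / (2 * u + c))"
    proof -
      have t1: "(s - x * c) / (s * s) / (x / s) = 1 / x - c / s"
        using cs(2) x by (simp add: field_simps)
      have t2: "(- (q * (1 / u) * s)) / (2 + c / u) = - q * (s / (2 * u + c))"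
        using cs(1,3) by (simp add: field_simps)
      show ?thesis unfolding e t1 t2 by (simp add: algebra_simps)
    qed
    also have "1 / x - c / s - s / (2 * u + c) = 1 / x - (c * (2 * u + c) + s * s) / (s * (2 * u + c))"
      using cs(1-3) by (simp add: divide_simps) (simp add: algebra_simps)
    also have "\<dots> = 1 / x - (2 * (c * u) + 1) / (s * (2 * u + c))"
      unfolding cs(4) by (simp add: algebra_simps)
    also have "q * \<dots> = q * (2 * (c * u) + 1) / (x * s * (2 * u + c))
        * (s * (2 * u + c) / (2 * (c * u) + 1) - x)"
    \<comment> \<open>Writing \<open>1 / x - N / M\<close> as
      \<open>N / (x * M) * (M / N - x)\<close> splits off a positive factor and leaves the gap
      function \<open>?E\<close>.\<close>
    proof -
      have "1 / x - N / M = N / (x * M) * (M / N - x)" if "N > 0" "M > 0" for N M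
        using that x by (simp add: field_simps)
      from this[of "2 * (c * u) + 1" "s * (2 * u + c)"] show ?thesis
        using cs by (simp add: add_pos_pos mult.assoc)
    qed
    also have "\<dots> = ?h x * ?E x"
      using e(3) by (simp add: c_def s_def u_def)
    finally show "(?D has_real_derivative ?h x * ?E x) (at x)" .
  qed
  then have "ln 3 < ln ((x / sin x) powr q) + ln (2 + cos x powr q)"
    using x sin_cos_pos[OF x] by (simp add: ln_powr)
  also have "\<dots> = ln ((x / sin x) powr q * (2 + cos x powr q))"
    using x sin_cos_pos[OF x] pos(1) by (subst ln_mult) (auto simp: less_imp_neq[symmetric])
  finally show ?thesis
    using x sin_cos_pos[OF x] pos(1) by (subst (asm) ln_less_cancel_iff) auto
qed

section \<open>Monotonicity in \<open>t\<close> and the critical exponent for general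
  \<open>k\<close>\<close>

text \<open>The derivative in \<open>s\<close> has the sign of a convexity defect: exp at
  \<open>- (\<delta> * u)\<close> lies below its chord between 0 and \<open>- u\<close>.\<close>

lemma exp_minus_one_ratio_mono:
  fixes \<delta> s t :: real
  assumes "0 < \<delta>" "\<delta> \<le> 1" "0 < s" "s \<le> t"
  shows "(exp t - 1) / (exp (\<delta> * t) - 1) \<ge> (exp s - 1) / (exp (\<delta> * s) - 1)"
proof -
  let ?f = "\<lambda>s. (exp s - 1) / (exp (\<delta> * s) - 1)"
  show ?thesis
  proof (rule DERIV_nonneg_imp_nondecreasing[OF \<open>s \<le> t\<close>])
    fix u assume "s \<le> u" "u \<le> t"
    then have u: "u > 0" using assms by simp
    have conv: "exp (- (\<delta> * u)) \<le> (1 - \<delta>) + \<delta> * exp (- u)"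
      using convex_onD[OF exp_convex, of \<delta> 0 "- u"] assms by (simp add: algebra_simps)
    have "(?f has_real_derivative
      (exp u * (exp (\<delta> * u) - 1) - (exp u - 1) * (\<delta> * exp (\<delta> * u))) / (exp (\<delta> * u) - 1)\<^sup>2) (at u)"
      using u assms by (auto intro!: derivative_eq_intros simp: power2_eq_square mult.commute)
    moreover have "exp u * (exp (\<delta> * u) - 1) - (exp u - 1) * (\<delta> * exp (\<delta> * u))
       = exp u * exp (\<delta> * u) * ((1 - \<delta>) + \<delta> * exp (- u) - exp (- (\<delta> * u)))"
      by (simp add: algebra_simps exp_minus)
    ultimately show "\<exists>y. (?f has_real_derivative y) (at u) \<and> 0 \<le> y"
      using conv by (intro exI conjI) auto
  qed
qed

text \<open>Both sides vanish at \<open>\<delta> = 1\<close>, and their derivatives in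
  \<open>\<delta>\<close> are the negatives of the ratios just compared. The right side minus the
  left is therefore nonincreasing in \<open>\<delta>\<close> and ends at 0.\<close>

lemma ln_one_minus_exp_ratio_mono:
  fixes \<delta> s t :: real
  assumes \<delta>: "0 < \<delta>" "\<delta> \<le> 1" and st: "0 < s" "s \<le> t"
  shows "(exp s - 1) / s * (ln (1 - exp (- s)) - ln (1 - exp (- (\<delta> * s))))
       \<le> (exp t - 1) / t * (ln (1 - exp (- t)) - ln (1 - exp (- (\<delta> * t))))"
proof -
  let ?M = "\<lambda>s \<delta>. (exp s - 1) / s * (ln (1 - exp (- s)) - ln (1 - exp (- (\<delta> * s))))"
  have der: "(?M s has_real_derivative - ((exp s - 1) / (exp (\<delta> * s) - 1))) (at \<delta>)"
    if "s > 0" "\<delta> > 0" for s \<delta> :: real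
  proof -
    have "(?M s has_real_derivative
       (exp s - 1) / s * (- (s * exp (- (\<delta> * s)) / (1 - exp (- (\<delta> * s)))))) (at \<delta>)"
      using that by (auto intro!: derivative_eq_intros)
    also have "exp (- (\<delta> * s)) / (1 - exp (- (\<delta> * s))) = 1 / (exp (\<delta> * s) - 1)"
      using that by (simp add: exp_minus divide_simps)
    then have "(exp s - 1) / s * (- (s * exp (- (\<delta> * s)) / (1 - exp (- (\<delta> * s)))))
      = (exp s - 1) / s * (- (s * (1 / (exp (\<delta> * s) - 1))))"
      by (simp only: flip: times_divide_eq_right)
    also have "\<dots> = - ((exp s - 1) / (exp (\<delta> * s) - 1))"
      using that by simp
    finally show ?thesis .
  qed
  have "?M t 1 - ?M s 1 \<le> ?M t \<delta> - ?M s \<delta>"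
  proof (rule DERIV_nonpos_imp_nonincreasing[OF \<delta>(2)])
    fix d assume d: "\<delta> \<le> d" "d \<le> 1"
    show "\<exists>y. ((\<lambda>d. ?M t d - ?M s d) has_real_derivative y) (at d) \<and> y \<le> 0"
      using DERIV_diff[OF der[of t d] der[of s d]] exp_minus_one_ratio_mono[of d s t] d \<delta> st
      by (intro exI conjI) auto
  qed
  then show ?thesis by simp
qed

text \<open>For exp s = (k + 2) / 2 one has k = 2 (exp s - 1) and 1 - exp (- s) = k / (k + 2), so
  the left side is the critical inequality. Taking logarithms isolates
  \<open>\<gamma>\<close>.\<close>

lemma one_less_exp_sum_iff:
  fixes \<gamma> \<delta> s :: real
  assumes "0 < \<delta>" "0 < s"
  shows "1 < exp (- (\<delta> * s)) + (1 - exp (- s)) * exp (- (\<gamma> * s / (2 * (exp s - 1))))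
    \<longleftrightarrow> \<gamma> / 2 < (exp s - 1) / s * (ln (1 - exp (- s)) - ln (1 - exp (- (\<delta> * s))))"
proof -
  define X Y z where "X = 1 - exp (- s)" and "Y = 1 - exp (- (\<delta> * s))"
    and "z = \<gamma> * s / (2 * (exp s - 1))"
  have pos: "0 < X" "0 < Y" using assms by (auto simp: X_def Y_def)
  have "1 < exp (- (\<delta> * s)) + X * exp (- z) \<longleftrightarrow> Y < X * exp (- z)"
    by (auto simp: Y_def)
  also have "\<dots> \<longleftrightarrow> ln Y < ln (X * exp (- z))"
    using pos by (subst ln_less_cancel_iff) auto
  also have "\<dots> \<longleftrightarrow> z < ln X - ln Y"
    using pos by (subst ln_mult) auto
  also have "\<dots> \<longleftrightarrow> \<gamma> / 2 < (exp s - 1) / s * (ln X - ln Y)"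
    using assms by (simp add: z_def field_simps)
  finally show ?thesis unfolding X_def z_def Y_def .
qed

lemma wilker_critical:
  fixes k x :: real
  defines "q \<equiv> ln ((k + 2) / 2) / (k * ln (pi / 2))"
  assumes k: "1 \<le> k" and x: "0 < x" "x < pi/2"
  shows "1 < 2 / (k + 2) * (x / sin x) powr (k * q) + k / (k + 2) * (x / tan x) powr q"
proof -
  note sc = sin_cos_pos[OF x]
  define a b P where "a = ln (x / sin x)" and "b = ln (x / tan x)" and "P = ln (pi / 2)"
  \<comment> \<open>Neither quantity depends on \<open>k\<close>. Since \<open>k * q = t / P\<close>
    and \<open>k = 2 * (exp t - 1)\<close>, the inequality involves \<open>k\<close> only through
    \<open>t\<close>.\<close>
  define \<delta> \<gamma> where "\<delta> = 1 - a / P" and "\<gamma> = - b / P"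
  define s t where "s = ln (3/2 :: real)" and "t = ln ((k + 2) / 2)"
  have P: "P > 0" using pi_ge_three by (simp add: P_def)
  have tan: "tan x > 0" using sc by (simp add: tan_def)
  have A: "(x / sin x) powr z = exp (z * a)" and B: "(x / tan x) powr z = exp (z * b)" for z
    using x sc tan by (simp_all add: powr_def a_def b_def)
  have st: "0 < s" "s \<le> t" "0 < t" using k by (auto simp: s_def t_def)
  have exp_s: "exp s = 3/2" and exp_t: "exp t = (k + 2) / 2"
    using k by (simp_all add: s_def t_def)
  have kqa: "k * q * a = t - \<delta> * t" and qb: "q * b = - (\<gamma> * t / k)"
    using k P by (simp_all add: q_def t_def[symmetric] P_def[symmetric] \<delta>_def \<gamma>_def algebra_simps)
  have first: "2 / (k + 2) * exp (k * q * a) = exp (- (\<delta> * t))"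
    unfolding kqa exp_diff exp_t using k by (simp add: exp_minus divide_simps)
  show ?thesis
  \<comment> \<open>The logarithm of \<open>1 - exp (- (\<delta> * t))\<close> calls for
    \<open>\<delta> > 0\<close>; otherwise the first summand alone is at least 1.\<close>
  proof (cases "\<delta> > 0")
    case False
    then have "exp (- (\<delta> * t)) \<ge> 1" using st by (simp add: mult_le_0_iff)
    moreover have "k / (k + 2) * (x / tan x) powr q > 0" using k x tan by simp
    ultimately show ?thesis unfolding A first by linarith
  next
    case \<delta>: True
    have "a \<ge> 0" using sin_x_le_x[of x] x sc by (simp add: a_def)
    then have \<delta>1: "\<delta> \<le> 1" using P by (simp add: \<delta>_def)
    have bc: "b = a + ln (cos x)"
      using x sc ln_mult[of "x / sin x" "cos x"] by (simp add: a_def b_def tan_def)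
    \<comment> \<open>For \<open>k = 1\<close> the value of \<open>t\<close> is \<open>s\<close> and
      the critical exponent is \<open>s / P\<close>.\<close>
    have "3 < exp (s / P * a) * (2 + exp (s / P * ln (cos x)))"
      using arg_over_sin_powr_gt[OF x] sc unfolding A s_def P_def by (simp add: powr_def)
    also have "\<dots> = 2 * exp (s / P * a) + exp (s / P * b)"
      unfolding bc by (simp add: algebra_simps add_divide_distrib exp_add)
    also have "s / P * a = s - \<delta> * s" using P by (simp add: \<delta>_def algebra_simps)
    also have "s / P * b = - (\<gamma> * s)" by (simp add: \<gamma>_def)
    finally have "1 < exp (- (\<delta> * s)) + (1 - exp (- s)) * exp (- (\<gamma> * s / (2 * (exp s - 1))))"
      unfolding exp_diff exp_s exp_minus[of s] by (simp add: exp_minus divide_simps)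
    then have "\<gamma> / 2 < (exp s - 1) / s * (ln (1 - exp (- s)) - ln (1 - exp (- (\<delta> * s))))"
      using one_less_exp_sum_iff \<delta> st by blast
    also have "\<dots> \<le> (exp t - 1) / t * (ln (1 - exp (- t)) - ln (1 - exp (- (\<delta> * t))))"
      using ln_one_minus_exp_ratio_mono \<delta> \<delta>1 st by blast
    finally have "1 < exp (- (\<delta> * t)) + (1 - exp (- t)) * exp (- (\<gamma> * t / (2 * (exp t - 1))))"
      using one_less_exp_sum_iff \<delta> st by blast
    also have "1 - exp (- t) = k / (k + 2)"
      unfolding exp_minus exp_t using k by (simp add: divide_simps)
    also have "- (\<gamma> * t / (2 * (exp t - 1))) = q * b"
      unfolding exp_t qb by (simp add: algebra_simps)
    finally show ?thesis unfolding A B first by simp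
  qed
qed

section \<open>Negative \<open>p\<close>: sufficiency beyond the critical exponent, and
  necessity\<close>

text \<open>Bernoulli's inequality for the base \<open>exp z\<close>, obtained from convexity of exp
  between 0 and \<open>l * z\<close>.\<close>

lemma bernoulli_exp:
  fixes l z :: real
  assumes "1 \<le> l"
  shows "1 + l * (exp z - 1) \<le> exp (l * z)"
proof -
  have "exp z \<le> (1 - 1 / l) + 1 / l * exp (l * z)"
    using convex_onD[OF exp_convex, of "1 / l" 0 "l * z"] assms by simp
  then have "l * exp z \<le> l * ((1 - 1 / l) + 1 / l * exp (l * z))"
    using assms by (intro mult_left_mono) auto
  also have "\<dots> = l - 1 + exp (l * z)"
    using assms by (simp add: algebra_simps)
  finally show ?thesis by (simp add: algebra_simps)
qed

text \<open>Replacing \<open>q0\<close> by \<open>l * q0\<close> raises both power terms to the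
  power \<open>l\<close>. As the weights sum to 1, Bernoulli's inequality shows that the excess over
  1 grows at least by the factor \<open>l\<close>.\<close>

lemma wilker_above_critical:
  fixes k q x :: real
  assumes q: "ln ((k + 2) / 2) / (k * ln (pi / 2)) \<le> q"
    and k: "1 \<le> k" and x: "0 < x" "x < pi/2"
  shows "1 < 2 / (k + 2) * (x / sin x) powr (k * q) + k / (k + 2) * (x / tan x) powr q"
proof -
  define q0 where "q0 = ln ((k + 2) / 2) / (k * ln (pi / 2))"
  define l where "l = q / q0"
  have q0: "q0 > 0" using k pi_ge_three by (auto simp: q0_def intro!: divide_pos_pos)
  then have l: "1 \<le> l" "q = l * q0" using q unfolding q0_def[symmetric] by (simp_all add: l_def)
  define u v where "u = k * q0 * ln (x / sin x)" and "v = q0 * ln (x / tan x)"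
  have nz: "x / sin x \<noteq> 0" "x / tan x \<noteq> 0"
    using sin_cos_pos[OF x] x by (auto simp: tan_def)
  have A: "(x / sin x) powr (k * q0) = exp u" "(x / sin x) powr (k * q) = exp (l * u)"
    and B: "(x / tan x) powr q0 = exp v" "(x / tan x) powr q = exp (l * v)"
    using nz by (simp_all add: powr_def u_def v_def l(2))
  have "0 < l * (2 / (k + 2) * exp u + k / (k + 2) * exp v - 1)"
    using wilker_critical[OF k x] l(1) unfolding q0_def[symmetric] A B by simp
  also have "\<dots> = 2 / (k + 2) * (1 + l * (exp u - 1)) + k / (k + 2) * (1 + l * (exp v - 1)) - 1"
    using k by (simp add: divide_simps) (simp add: algebra_simps)
  also have "\<dots> \<le> 2 / (k + 2) * exp (l * u) + k / (k + 2) * exp (l * v) - 1"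
    using k l(1) by (intro diff_right_mono add_mono mult_left_mono bernoulli_exp) auto
  finally show ?thesis unfolding A B by simp
qed

lemma wilker_critical_necessary:
  fixes k q :: real
  assumes k: "1 \<le> k" and q: "0 < q"
    and gt: "\<And>x. 0 < x \<Longrightarrow> x < pi/2 \<Longrightarrow>
      1 < 2 / (k + 2) * (x / sin x) powr (k * q) + k / (k + 2) * (x / tan x) powr q"
  shows "ln ((k + 2) / 2) / (k * ln (pi / 2)) \<le> q"
proof -
  \<comment> \<open>The tangent is replaced by sine and cosine so that the limit at pi/2 can be read
    off: the second term vanishes because \<open>q > 0\<close>.\<close>
  let ?F = "\<lambda>x. 2 / (k + 2) * (x / sin x) powr (k * q) + k / (k + 2) * ((x / sin x) powr q * cos x powr q)"
  have lim: "((\<lambda>x. (x / sin x) powr z) \<longlongrightarrow> ((pi/2) / sin (pi/2)) powr z) (at_left (pi/2))" for z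
    by (intro tendsto_intros) auto
  have "(?F \<longlongrightarrow> 2 / (k + 2) * ((pi/2) / sin (pi/2)) powr (k * q)
      + k / (k + 2) * (((pi/2) / sin (pi/2)) powr q * 0)) (at_left (pi/2))"
    by (intro tendsto_add tendsto_mult tendsto_const lim tendsto_cos_powr_at_left_pi_half q)
  then have F: "(?F \<longlongrightarrow> 2 / (k + 2) * (pi/2) powr (k * q)) (at_left (pi/2))" by simp
  have "eventually (\<lambda>x. x \<in> {0<..<pi/2}) (at_left (pi/2))"
    by (rule eventually_at_left_real) simp
  then have "eventually (\<lambda>x. 1 \<le> ?F x) (at_left (pi/2))"
  proof eventually_elim
    case (elim x)
    then have x: "0 < x" "x < pi/2" by auto
    have "x / tan x = (x / sin x) * cos x" by (simp add: tan_def)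
    then have "(x / tan x) powr q = (x / sin x) powr q * cos x powr q"
      using x sin_cos_pos[OF x] by (metis powr_mult)
    then show ?case using gt[OF x] by simp
  qed
  then have "1 \<le> 2 / (k + 2) * (pi/2) powr (k * q)"
    using tendsto_lowerbound[OF F] by simp
  then have "(k + 2) / 2 \<le> (pi/2) powr (k * q)"
    using k by (simp add: field_simps)
  then have "ln ((k + 2) / 2) \<le> ln ((pi/2) powr (k * q))"
    using k by (subst ln_le_cancel_iff) auto
  also have "\<dots> = k * q * ln (pi/2)" by (simp add: ln_powr)
  finally show ?thesis
    using k pi_ge_three by (simp add: divide_le_eq mult_ac)
qed

section \<open>Positive exponents\<close>

text \<open>The sum equals 3 ln (sin x) - ln (cos x) - 3 ln x. Its positivity is the cube of sin x /
  (cos x)^(1/3) > x, a form in which \<open>x\<close> drops out on differentiation.\<close>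

lemma two_ln_sinc_plus_ln_tanc_pos:
  assumes x: "0 < x" "x < pi/2"
  shows "0 < 2 * ln (sin x / x) + ln (tan x / x)"
proof -
  let ?f = "\<lambda>x::real. sin x * cos x powr (-1/3) - x"
  let ?f' = "\<lambda>x. cos x * cos x powr (-1/3) + (sin x)\<^sup>2 * cos x powr (-4/3) / 3 - 1"
  note sc = sin_cos_pos[OF x]
  have "0 < ?f x"
  proof (rule pos_if_deriv_pos_at_right[OF x(1)])
    have "isCont ?f 0" by (intro continuous_intros) auto
    then show "(?f \<longlongrightarrow> 0) (at_right 0)"
      by (auto simp: isCont_def intro: filterlim_mono[OF _ order_refl at_le])
    fix z :: real assume z: "0 < z"
    {
      assume "z \<le> x"
      then show "(?f has_real_derivative ?f' z) (at z)"
        using sin_cos_pos[of z] z x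
        by (auto intro!: derivative_eq_intros simp: power2_eq_square)
    }
    assume "z < x"
    note scz = sin_cos_pos[of z]
    \<comment> \<open>The cube root of the cosine makes the derivative a rational function of
      \<open>w\<close>, with a square in its numerator.\<close>
    define w where "w = cos z powr (1/3)"
    have w: "0 < w" "w < 1"
      using scz z \<open>z < x\<close> x powr_less_mono2[of "1/3" "cos z" 1] by (auto simp: w_def)
    have w3: "w ^ 3 = w powr 3" using w by simp
    have c: "cos z = w ^ 3"
      using scz(2) z \<open>z < x\<close> x unfolding w3 unfolding w_def powr_powr by simp
    have e: "cos z powr (-1/3) = 1 / w" "cos z powr (-4/3) = 1 / w ^ 4"
      using w(1) unfolding c w3 powr_powr by (simp_all add: powr_minus_divide)
    have "?f' z = w ^ 3 * (1 / w) + (1 - (w ^ 3)\<^sup>2) * (1 / w ^ 4) / 3 - 1"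
      unfolding e sin_squared_eq unfolding c ..
    also have "\<dots> = (w\<^sup>2 - 1)\<^sup>2 * (2 * w\<^sup>2 + 1) / (3 * w ^ 4)"
      using w(1) by (simp add: divide_simps) algebra
    finally have "?f' z = (w\<^sup>2 - 1)\<^sup>2 * (2 * w\<^sup>2 + 1) / (3 * w ^ 4)" .
    moreover have "w\<^sup>2 < 1" using w by (simp add: power_less_one_iff)
    ultimately show "0 < ?f' z" using w by (simp add: add_pos_pos)
  qed
  then have "ln x < ln (sin x * cos x powr (-1/3))"
    using x sc by (subst ln_less_cancel_iff) auto
  also have "\<dots> = ln (sin x) - ln (cos x) / 3"
    using sc by (simp add: ln_mult ln_powr)
  finally have "0 < 3 * ln (sin x) - ln (cos x) - 3 * ln x" by simp
  then show ?thesis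
    using x sc by (simp add: tan_def ln_div ln_mult)
qed

text \<open>The bound exp z \<ge> 1 + z is applied to each power. The weights give the linear terms
  the common factor k p / (k + 2), leaving exactly \<open>2 * a + b\<close>.\<close>

lemma wilker_positive_exponent:
  fixes k p x :: real
  assumes k: "1 \<le> k" and p: "0 < p" and x: "0 < x" "x < pi/2"
  shows "1 < 2 / (k + 2) * (sin x / x) powr (k * p) + k / (k + 2) * (tan x / x) powr p"
proof -
  define a b where "a = ln (sin x / x)" and "b = ln (tan x / x)"
  have "sin x / x \<noteq> 0" "tan x / x \<noteq> 0"
    using sin_cos_pos[OF x] x by (auto simp: tan_def)
  then have AB: "(sin x / x) powr (k * p) = exp (k * p * a)" "(tan x / x) powr p = exp (p * b)"
    by (simp_all add: powr_def a_def b_def)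
  have "0 < k * p * (2 * a + b) / (k + 2)"
    using two_ln_sinc_plus_ln_tanc_pos[OF x] k p by (simp add: a_def b_def)
  then have "1 < 2 / (k + 2) * (1 + k * p * a) + k / (k + 2) * (1 + p * b)"
    using k by (simp add: divide_simps) (simp add: algebra_simps)
  also have "\<dots> \<le> 2 / (k + 2) * exp (k * p * a) + k / (k + 2) * exp (p * b)"
    using k by (intro add_mono mult_left_mono exp_ge_add_one_self) auto
  finally show ?thesis unfolding AB .
qed

section \<open>Inverting the quotients, and the equivalence\<close>

lemma powr_swap_divide:
  fixes a b z :: real
  assumes "0 < a" "0 < b"
  shows "(a / b) powr z = (b / a) powr (- z)"
  using assms by (simp add: powr_def ln_div algebra_simps)

theorem theorem3p1:
  fixes k p :: real
  assumes "k \<ge> 1" and "p \<noteq> 0"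
  shows "(\<forall>x\<in>{0<..<pi/2}.
            2 / (k + 2) * (sin x / x) powr (k * p) + k / (k + 2) * (tan x / x) powr p > 1)
         \<longleftrightarrow> (p > 0 \<or> p \<le> - (ln (k + 2) - ln 2) / (k * (ln pi - ln 2)))"
    (is "?L \<longleftrightarrow> _")
proof (cases "p > 0")
  case True
  then show ?thesis using wilker_positive_exponent assms by auto
next
  case False
  then have q: "0 < - p" using assms by simp
  \<comment> \<open>Inverting both quotients turns the negative exponent \<open>p\<close> into the
    positive exponent \<open>- p\<close> of the preceding results.\<close>
  have swap: "(sin x / x) powr (k * p) = (x / sin x) powr (k * - p)"
      "(tan x / x) powr p = (x / tan x) powr - p" if "0 < x" "x < pi/2" for x
    using powr_swap_divide[of "sin x" x "k * p"] powr_swap_divide[of "tan x" x p]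
      sin_cos_pos[OF that] that by (simp_all add: tan_def)
  have "?L \<longleftrightarrow> (\<forall>x. 0 < x \<longrightarrow> x < pi/2 \<longrightarrow>
      1 < 2 / (k + 2) * (x / sin x) powr (k * - p) + k / (k + 2) * (x / tan x) powr - p)"
    using swap by auto
  also have "\<dots> \<longleftrightarrow> ln ((k + 2) / 2) / (k * ln (pi / 2)) \<le> - p"
    using wilker_above_critical[OF _ assms(1)] wilker_critical_necessary[OF assms(1) q] by blast
  also have "ln ((k + 2) / 2) / (k * ln (pi / 2)) = (ln (k + 2) - ln 2) / (k * (ln pi - ln 2))"
    using assms(1) by (simp add: ln_div)
  also have "\<dots> \<le> - p \<longleftrightarrow> p \<le> - (ln (k + 2) - ln 2) / (k * (ln pi - ln 2))"
    unfolding minus_divide_left[symmetric] by linarith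
  finally show ?thesis using False by simp
qed

end
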